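(* Let $J\ge 2$ and let $0=t_0<t_1<t_2<\dots<t_J$ be known real numbers. For parameters $C_0>0$, $d>0$, $\lambda\ge 0$, $s\in(0,1]$ define, for $z>0$ and $x'\in\mathbb{R}^2$, $$g(x',z)=C_0e^{-\lambda z}\,\frac{1}{4\pi^2}\int_{\mathbb{R}^2}e^{i x'\cdot\xi}\,e^{-A_s(z)|\xi|^{2s}}\,d\xi,\qquad A_s(z)=d\int_0^z|z-r|^{2s}\,dr=\frac{d}{2s+1}z^{2s+1}.$$ Let $z_0>0$ and set $z_j=z_0+t_j$ for $0\le j\le J$. Then the finite collection of data $$g(0,z_j)\quad\text{and}\quad \int_{\mathbb{R}^2}g(x',z_j)\,dx'=C_0e^{-\lambda z_j},\qquad 0\le j\le J,$$ uniquely determines the parameters $(C_0,d,\lambda,s,z_0)$. That is, if two parameter tuples $(C_0,d,\lambda,s,z_0)$ and $(\hat C_0,\hat d,\hat\lambda,\hat s,\hat z_0)$ in $(0,\infty)\times(0,\infty)\times[0,\infty)\times(0,1]\times(0,\infty)$ produce the same data (with the same known $t_0,\dots,t_J$), then the two tuples are equal.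
   Context: Physical meaning: $g$ is the density, integrated over angles and multiplied by an isotropic constant wide-angle scattering coefficient $\sigma>0$, of a (fractional) Fermi pencil beam in $\mathbb{R}^3$. It has constant absorption $\lambda$, constant diffusion $\epsilon^{2s}D$ and fractional exponent $s$ ($s=1$ being the local case), and is generated by a source of strength $F_0>0$ that is a delta function at the origin in the direction $(0,0,1)$. Here $C_0=\sigma F_0$ and $d=\epsilon^{2s}D$. The variable $z$ is the distance to the source along the beam axis and $x'\in\mathbb{R}^2$ is the transverse variable. The distances $t_j$ between the observation points along the axis are known, while the distance $z_0$ from the source to the first observation point is unknown. *)

theory Defs
  imports "HOL-Analysis.Analysis"
begin

definition spread :: "real \<Rightarrow> real \<Rightarrow> real \<Rightarrow> real" where
  "spread d s z = d * (LBINT r:{0..z}. \<bar>z - r\<bar> powr (2 * s))"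

text \<open>The beam density is kept complex-valued, exactly as its Fourier formula defines it;
  its values are in fact real by symmetry in the frequency variable.\<close>

definition beam ::
  "real \<Rightarrow> real \<Rightarrow> real \<Rightarrow> real \<Rightarrow> real ^ 2 \<Rightarrow> real \<Rightarrow> complex" where
  "beam C\<^sub>0 d lam s x z =
     complex_of_real (C\<^sub>0 * exp (- lam * z)) * complex_of_real (1 / (4 * pi\<^sup>2)) *
     (LINT \<xi>|lborel. exp (\<i> * complex_of_real (x \<bullet> \<xi>)) *
        complex_of_real (exp (- spread d s z * norm \<xi> powr (2 * s))))"

text \<open>Admissible tuples \<open>(C\<^sub>0, d, lam, s, z\<^sub>0)\<close>.\<close>

definition beam_params :: "(real \<times> real \<times> real \<times> real \<times> real) set" where
  "beam_params = {0<..} \<times> {0<..} \<times> {0..} \<times> {0<..1} \<times> {0<..}"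

end

theory Submission
  imports Defs "HOL-Probability.Probability" "HOL-Real_Asymp.Real_Asymp"
begin

text \<open>
  \<^bold>\<open>Mass of the beam.\<close> The transverse profile is the Fourier transform \<open>F\<close> of
  \<open>exp (- A |\<xi>|\<^sup>2\<^sup>s)\<close>, which for \<open>s < 1\<close> is not smooth at the origin, so the integrability of \<open>F\<close> is
  not evident. The route taken is positivity. For \<open>0 < s \<le> 1\<close> the function \<open>exp (- A r\<^sup>s)\<close> is a bounded limit of nonnegative
  combinations of \<open>exp (- u r)\<close>: the binomial series of \<open>1 - (1 - x)\<^sup>s\<close> has nonnegative
  coefficients, the exponential series keeps nonnegativity, and \<open>n\<^sup>s (1 - exp (- r / n))\<^sup>s\<close> tends to
  \<open>r\<^sup>s\<close> (\<open>gaussian_mixture_stretched_exp\<close>). With \<open>r = |\<xi>|\<^sup>2\<close> the profile is a limit of combinations of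
  Gaussians, so \<open>F \<ge> 0\<close> (\<open>gaussian_mixture_fourier_nonneg\<close>). A nonnegative Fourier transform is
  integrable with integral \<open>(2\<pi>)\<^sup>2\<close> times the value of the transformed function at the origin
  (\<open>has_bochner_integral_nonneg_fourier\<close>), which gives the mass \<open>C\<^sub>0 exp (- lam z)\<close> (\<open>beam_mass\<close>).

  \<^bold>\<open>Value on the axis.\<close> Scaling \<open>\<xi>\<close> by \<open>A\<close> to the power \<open>1 / (2 s)\<close> shows that the on-axis density is
  the mass times \<open>K z powr (- (2 + 1/s)) / (4\<pi>\<^sup>2)\<close>, where \<open>K > 0\<close> depends only on \<open>d\<close> and \<open>s\<close>
  (\<open>beam_axis\<close>).

  \<^bold>\<open>Uniqueness.\<close> The masses at \<open>t\<^sub>0\<close> and \<open>t\<^sub>1\<close> determine \<open>lam\<close>. Dividing by the mass and taking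
  logarithms, \<open>(2 + 1/s) ln (z\<^sub>0 + t)\<close> and its counterpart differ by a constant at the three points
  \<open>t\<^sub>0, t\<^sub>1, t\<^sub>2\<close>; by Rolle's theorem this forces equal \<open>s\<close> and \<open>z\<^sub>0\<close>
  (\<open>ln_profile_three_points\<close>). Then the mass gives \<open>C\<^sub>0\<close>, and \<open>K\<close> gives \<open>d\<close>.
\<close>

section \<open>Mixtures of Gaussians\<close>

text \<open>The closed convex cone generated by the functions \<open>r \<mapsto> exp (- u r)\<close>, \<open>u \<ge> 0\<close>, under bounded
  pointwise convergence on \<open>r > 0\<close>; by Bernstein's theorem their restrictions to \<open>r > 0\<close> are the
  bounded completely monotone functions. Read at \<open>r = |\<xi>|\<^sup>2\<close> the generators are centred Gaussians (or the constant
  one for \<open>u = 0\<close>). The value at \<open>r = 0\<close> is left unconstrained, because the binomial series of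
  \<open>(1 - x)\<^sup>s\<close> at \<open>x = exp (- u r)\<close> is used inside its disc of convergence only; it is irrelevant for integrals over the frequency space.
  Measurability of a limit is demanded explicitly since nothing controls it for \<open>r \<le> 0\<close>.\<close>

inductive gaussian_mixture :: "(real \<Rightarrow> real) \<Rightarrow> bool" where
  exp: "0 \<le> u \<Longrightarrow> gaussian_mixture (\<lambda>r. exp (- (u * r)))"
| scale: "0 \<le> c \<Longrightarrow> gaussian_mixture f \<Longrightarrow> gaussian_mixture (\<lambda>r. c * f r)"
| add: "gaussian_mixture f \<Longrightarrow> gaussian_mixture g \<Longrightarrow> gaussian_mixture (\<lambda>r. f r + g r)"
| limit: "(\<And>n::nat. gaussian_mixture (f n)) \<Longrightarrow> (\<And>n r. 0 < r \<Longrightarrow> \<bar>f n r\<bar> \<le> B) \<Longrightarrow>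
    (\<And>r. 0 < r \<Longrightarrow> (\<lambda>n. f n r) \<longlonglongrightarrow> g r) \<Longrightarrow> g \<in> borel_measurable borel \<Longrightarrow> gaussian_mixture g"

lemma gaussian_mixture_measurable:
  "gaussian_mixture f \<Longrightarrow> f \<in> borel_measurable borel"
  by (induction rule: gaussian_mixture.induct) auto

lemma gaussian_mixture_bounded:
  "gaussian_mixture f \<Longrightarrow> \<exists>B\<ge>0. \<forall>r>0. \<bar>f r\<bar> \<le> B"
proof (induction rule: gaussian_mixture.induct)
  case (exp u)
  then show ?case by (intro exI[of _ 1]) auto
next
  case (scale c f)
  then obtain B where B: "B \<ge> 0" "\<And>r. r > 0 \<Longrightarrow> \<bar>f r\<bar> \<le> B" by auto
  show ?case
    by (rule exI[of _ "c * B"]) (use scale B in \<open>auto simp: abs_mult intro: mult_left_mono\<close>)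
next
  case (add f g)
  then obtain B B' where B: "B \<ge> 0" "\<And>r. r > 0 \<Longrightarrow> \<bar>f r\<bar> \<le> B"
    and B': "B' \<ge> 0" "\<And>r. r > 0 \<Longrightarrow> \<bar>g r\<bar> \<le> B'" by auto
  show ?case
  proof (intro exI[of _ "B + B'"] conjI allI impI)
    fix r :: real assume "r > 0"
    from B(2)[OF this] B'(2)[OF this] show "\<bar>f r + g r\<bar> \<le> B + B'" by linarith
  qed (use B B' in simp)
next
  case (limit f B g)
  show ?case
  proof (intro exI[of _ B] conjI allI impI)
    show "\<bar>g r\<bar> \<le> B" if "r > 0" for r
      by (rule LIMSEQ_le_const2[OF tendsto_rabs[OF limit.hyps(3)[OF that]]])
        (use limit.hyps(2)[OF that] in blast)
    show "0 \<le> B" using limit.hyps(2)[of 1 0] by linarith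
  qed
qed

lemma gaussian_mixture_const: "0 \<le> c \<Longrightarrow> gaussian_mixture (\<lambda>_. c)"
  using gaussian_mixture.scale[OF _ gaussian_mixture.exp[of 0], of c] by simp

lemma gaussian_mixture_sum:
  "finite I \<Longrightarrow> (\<And>i. i \<in> I \<Longrightarrow> gaussian_mixture (f i)) \<Longrightarrow> gaussian_mixture (\<lambda>r. \<Sum>i\<in>I. f i r)"
  by (induction rule: finite_induct) (auto intro: gaussian_mixture_const gaussian_mixture.add)

lemma gaussian_mixture_exp_mult:
  assumes "gaussian_mixture g" "0 \<le> u"
  shows "gaussian_mixture (\<lambda>r. exp (- (u * r)) * g r)"
  using assms(1)
proof (induction rule: gaussian_mixture.induct)
  case (exp v)
  then show ?case
    using gaussian_mixture.exp[of "u + v"] assms(2) by (simp add: exp_add[symmetric] algebra_simps)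
next
  case (scale c f)
  then show ?case
    using gaussian_mixture.scale[OF scale.hyps(1) scale.IH] by (simp add: mult_ac)
next
  case (add f g)
  then show ?case
    using gaussian_mixture.add[OF add.IH] by (simp add: distrib_left)
next
  case (limit f B g)
  show ?case
  proof (rule gaussian_mixture.limit[where f = "\<lambda>n r. exp (- (u * r)) * f n r" and B = B])
    show "\<bar>exp (- (u * r)) * f n r\<bar> \<le> B" if "0 < r" for n r
      using limit.hyps(2)[OF that, of n] mult_mono[of "exp (- (u * r))" 1 "\<bar>f n r\<bar>" B] that assms(2)
      by (auto simp: abs_mult)
  qed (use limit in \<open>auto intro!: tendsto_intros\<close>)
qed

text \<open>Closure under products is what allows exponentials of mixtures to be formed. It is proved by
  induction on both factors, the previous lemma being the induction on the second one.\<close>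

lemma gaussian_mixture_mult:
  assumes "gaussian_mixture f" "gaussian_mixture g"
  shows "gaussian_mixture (\<lambda>r. f r * g r)"
  using assms(1)
proof (induction rule: gaussian_mixture.induct)
  case (exp u)
  then show ?case using gaussian_mixture_exp_mult[OF assms(2)] by simp
next
  case (scale c f)
  then show ?case
    using gaussian_mixture.scale[OF scale.hyps(1) scale.IH] by (simp add: mult_ac)
next
  case (add f g)
  then show ?case
    using gaussian_mixture.add[OF add.IH] by (simp add: distrib_right)
next
  case (limit f B h)
  obtain B' where B': "B' \<ge> 0" "\<And>r. r > 0 \<Longrightarrow> \<bar>g r\<bar> \<le> B'"
    using gaussian_mixture_bounded[OF assms(2)] by blast
  show ?case
  proof (rule gaussian_mixture.limit[where f = "\<lambda>n r. f n r * g r" and B = "B * B'"])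
    show "\<bar>f n r * g r\<bar> \<le> B * B'" if "0 < r" for n r
      unfolding abs_mult using limit.hyps(2)[OF that, of n] B'(2)[OF that]
      by (intro mult_mono) auto
  qed (use limit gaussian_mixture_measurable[OF assms(2)] in \<open>auto intro!: tendsto_intros\<close>)
qed

lemma gaussian_mixture_power: "gaussian_mixture f \<Longrightarrow> gaussian_mixture (\<lambda>r. f r ^ n)"
  by (induction n) (auto intro: gaussian_mixture_const gaussian_mixture_mult)

lemma gaussian_mixture_exp_comp:
  assumes "gaussian_mixture h"
  shows "gaussian_mixture (\<lambda>r. exp (h r))"
proof -
  obtain B where B: "B \<ge> 0" "\<And>r. r > 0 \<Longrightarrow> \<bar>h r\<bar> \<le> B"
    using gaussian_mixture_bounded[OF assms] by blast
  have series: "(\<lambda>k. (1 / fact k) * x ^ k) sums exp x" for x :: real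
    using exp_converges[of x] by (simp add: divide_inverse mult.commute)
  show ?thesis
  proof (rule gaussian_mixture.limit[where f = "\<lambda>n r. \<Sum>k<n. (1 / fact k) * h r ^ k" and B = "exp B"])
    show "gaussian_mixture (\<lambda>r. \<Sum>k<n. (1 / fact k) * h r ^ k)" for n
      by (intro gaussian_mixture_sum gaussian_mixture.scale gaussian_mixture_power assms) auto
    show "\<bar>\<Sum>k<n. (1 / fact k) * h r ^ k\<bar> \<le> exp B" if "0 < r" for n r
    proof -
      have "\<bar>\<Sum>k<n. (1 / fact k) * h r ^ k\<bar> \<le> (\<Sum>k<n. \<bar>(1 / fact k) * h r ^ k\<bar>)"
        by (rule sum_abs)
      also have "\<dots> \<le> (\<Sum>k<n. (1 / fact k) * B ^ k)"
        using B(2)[OF that]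
        by (intro sum_mono) (auto simp: abs_mult power_abs intro!: divide_right_mono power_mono)
      also have "\<dots> \<le> exp B"
        using series[of B] B(1)
        by (metis (no_types, lifting) sum_le_suminf sums_iff finite_lessThan fact_ge_zero
            divide_nonneg_nonneg mult_nonneg_nonneg zero_le_one zero_le_power)
      finally show ?thesis .
    qed
    show "(\<lambda>n. \<Sum>k<n. (1 / fact k) * h r ^ k) \<longlonglongrightarrow> exp (h r)" for r
      using series[of "h r"] by (simp add: sums_def)
    show "(\<lambda>r. exp (h r)) \<in> borel_measurable borel"
      using gaussian_mixture_measurable[OF assms] by measurable
  qed
qed

text \<open>Apart from the constant term, the coefficients of \<open>(1 - x)\<^sup>s\<close> as a power series in \<open>x\<close> are
  nonpositive when \<open>0 < s \<le> 1\<close>.\<close>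

lemma minus_gbinomial_alternating_nonneg:
  fixes s :: real
  assumes "0 < s" "s \<le> 1"
  shows "0 \<le> - ((s gchoose Suc k) * (- 1) ^ Suc k)"
proof -
  have "pochhammer (- s) (Suc k) = (- s) * pochhammer (1 - s) k"
    by (subst pochhammer_rec) simp
  moreover have "0 \<le> pochhammer (1 - s) k"
    unfolding pochhammer_prod using assms by (intro prod_nonneg) auto
  ultimately have "pochhammer (- s) (Suc k) \<le> 0"
    using assms by (simp add: mult_nonneg_nonneg)
  moreover have "(s gchoose Suc k) * (- 1) ^ Suc k = pochhammer (- s) (Suc k) / fact (Suc k)"
    unfolding gbinomial_pochhammer
    by (simp del: pochhammer_Suc fact_Suc flip: power_mult_distrib)
  ultimately show ?thesis
    by (simp add: divide_nonpos_nonneg)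
qed

text \<open>Hence \<open>1 - (1 - x)\<^sup>s\<close> with \<open>x = exp (- u r)\<close> is a series in the functions \<open>exp (- u k r)\<close>,
  \<open>k \<ge> 1\<close>, with nonnegative coefficients.\<close>

lemma gaussian_mixture_binomial:
  assumes s: "0 < s" "s \<le> 1" and "0 < u"
  shows "gaussian_mixture (\<lambda>r. 1 - (1 - exp (- (u * r))) powr s)"
proof -
  define b where "b k = - ((s gchoose Suc k) * (- 1) ^ Suc k)" for k
  have b_nonneg: "0 \<le> b k" for k
    unfolding b_def by (rule minus_gbinomial_alternating_nonneg[OF s])
  have series: "(\<lambda>k. b k * exp (- (u * r)) ^ Suc k) sums (1 - (1 - exp (- (u * r))) powr s)"
    if "0 < r" for r
  proof -
    define x where "x = exp (- (u * r))"
    have "0 < x" "x < 1" using that \<open>0 < u\<close> by (auto simp: x_def)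
    then have "(\<lambda>n. (s gchoose n) * (- x) ^ n) sums (1 - x) powr s"
      using gen_binomial_real[of "- x" s] by simp
    then have "(\<lambda>n. (s gchoose Suc n) * (- x) ^ Suc n) sums ((1 - x) powr s - 1)"
      by (subst sums_Suc_iff) simp
    from sums_minus[OF this] have "(\<lambda>n. - ((s gchoose Suc n) * (- x) ^ Suc n)) sums (1 - (1 - x) powr s)"
      by simp
    moreover have "- ((s gchoose Suc n) * (- x) ^ Suc n) = b n * x ^ Suc n" for n
      unfolding b_def power_minus[of x] by (simp only: mult_minus_left mult.assoc)
    ultimately show ?thesis by (simp only: x_def)
  qed
  show ?thesis
  proof (rule gaussian_mixture.limit[where f = "\<lambda>n r. \<Sum>k<n. b k * exp (- (u * r)) ^ Suc k" and B = 1])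
    show "gaussian_mixture (\<lambda>r. \<Sum>k<n. b k * exp (- (u * r)) ^ Suc k)" for n
      using \<open>0 < u\<close> b_nonneg
      by (intro gaussian_mixture_sum gaussian_mixture.scale gaussian_mixture_power gaussian_mixture.exp) auto
    show "(\<lambda>n. \<Sum>k<n. b k * exp (- (u * r)) ^ Suc k) \<longlonglongrightarrow> 1 - (1 - exp (- (u * r))) powr s"
      if "0 < r" for r
      using series[OF that] by (simp only: sums_def)
    show "\<bar>\<Sum>k<n. b k * exp (- (u * r)) ^ Suc k\<bar> \<le> 1" if "0 < r" for n r
    proof -
      have nonneg: "0 \<le> b k * exp (- (u * r)) ^ Suc k" for k
        using b_nonneg by (intro mult_nonneg_nonneg) auto
      have "(\<Sum>k<n. b k * exp (- (u * r)) ^ Suc k) \<le> 1 - (1 - exp (- (u * r))) powr s"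
        using series[OF that] sum_le_suminf[of "\<lambda>k. b k * exp (- (u * r)) ^ Suc k" "{..<n}"] nonneg
        by (auto simp only: sums_iff finite_lessThan)
      also have "\<dots> \<le> 1" by simp
      finally show ?thesis
        using sum_nonneg[of "{..<n}" "\<lambda>k. b k * exp (- (u * r)) ^ Suc k"] nonneg
        by (simp only: abs_of_nonneg)
    qed
  qed measurable
qed

text \<open>Since \<open>r\<^sup>s\<close> is the limit of \<open>n\<^sup>s (1 - exp (- r / n))\<^sup>s\<close>, the function \<open>exp (- A r\<^sup>s)\<close> is the limit of
  \<open>exp (- A n\<^sup>s) exp (A n\<^sup>s h\<^sub>n)\<close>, where \<open>h\<^sub>n = 1 - (1 - exp (- r / n))\<^sup>s\<close> is a mixture.\<close>

theorem gaussian_mixture_stretched_exp: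
  assumes s: "0 < s" "s \<le> 1" and A: "0 < A"
  shows "gaussian_mixture (\<lambda>r. exp (- A * r powr s))"
proof (rule gaussian_mixture.limit[where B = 1 and
    f = "\<lambda>n r. exp (- A * (real (Suc n) * (1 - exp (- (1 / real (Suc n) * r)))) powr s)"])
  show "gaussian_mixture (\<lambda>r. exp (- A * (real (Suc n) * (1 - exp (- (1 / real (Suc n) * r)))) powr s))"
    (is "gaussian_mixture ?f") for n
  proof -
    have "gaussian_mixture (\<lambda>r. exp (- (A * real (Suc n) powr s)) *
        exp ((A * real (Suc n) powr s) * (1 - (1 - exp (- (1 / real (Suc n) * r))) powr s)))"
      using s A by (intro gaussian_mixture.scale gaussian_mixture_exp_comp gaussian_mixture_binomial) auto
    moreover have "exp (- (A * real (Suc n) powr s)) *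
        exp ((A * real (Suc n) powr s) * (1 - (1 - exp (- (1 / real (Suc n) * r))) powr s)) = ?f r" for r
      unfolding powr_mult by (simp only: exp_add[symmetric]) (simp add: algebra_simps)
    ultimately show ?thesis by (simp only:)
  qed
  show "(\<lambda>n. exp (- A * (real (Suc n) * (1 - exp (- (1 / real (Suc n) * r)))) powr s))
      \<longlonglongrightarrow> exp (- A * r powr s)" if "0 < r" for r
  proof -
    have "(\<lambda>n. real (Suc n) * (1 - exp (- (1 / real (Suc n) * r)))) \<longlonglongrightarrow> r"
      by real_asymp
    then show ?thesis using that by (intro tendsto_intros) auto
  qed
qed (use A in auto)

section \<open>Fourier transforms of Gaussians\<close>

lemma has_bochner_integral_density_iff:
  fixes f :: "'a \<Rightarrow> 'b::{banach, second_countable_topology}" and g :: "'a \<Rightarrow> real"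
  assumes "f \<in> borel_measurable M" "g \<in> borel_measurable M" "AE x in M. 0 \<le> g x"
  shows "has_bochner_integral (density M g) f I \<longleftrightarrow> has_bochner_integral M (\<lambda>x. g x *\<^sub>R f x) I"
  by (simp only: has_bochner_integral_iff integrable_density[OF assms] integral_density[OF assms])

lemma has_bochner_integral_distr_iff:
  fixes f :: "'a \<Rightarrow> 'b::{banach, second_countable_topology}"
  assumes "f \<in> borel_measurable N" "g \<in> measurable M N"
  shows "has_bochner_integral (distr M N g) f I \<longleftrightarrow> has_bochner_integral M (\<lambda>x. f (g x)) I"
  by (simp only: has_bochner_integral_iff integrable_distr_eq[OF assms(2,1)] integral_distr[OF assms(2,1)])


lemma lborel_has_bochner_integral_scaleR:
  fixes f :: "'a::euclidean_space \<Rightarrow> 'b::{banach, second_countable_topology}"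
  assumes "c \<noteq> 0" "has_bochner_integral lborel f I"
  shows "has_bochner_integral lborel (\<lambda>x. f (c *\<^sub>R x)) (I /\<^sub>R \<bar>c\<bar> ^ DIM('a))"
proof -
  have [measurable]: "f \<in> borel_measurable borel"
    using assms(2) by (auto simp: has_bochner_integral_iff)
  have "has_bochner_integral (density (distr lborel borel (\<lambda>x. 0 + c *\<^sub>R x)) (\<lambda>_. ennreal (\<bar>c\<bar> ^ DIM('a)))) f I"
    using assms(2) unfolding lborel_affine[OF assms(1), of 0, symmetric]
    by (simp only: ennreal_power[OF abs_ge_zero] lborel_affine[OF assms(1), of 0, symmetric])
  then have "has_bochner_integral lborel (\<lambda>x. \<bar>c\<bar> ^ DIM('a) *\<^sub>R f (c *\<^sub>R x)) I"
    by (subst (asm) has_bochner_integral_density_iff, simp, simp, simp,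
      subst (asm) has_bochner_integral_distr_iff) simp_all
  from has_bochner_integral_scaleR_right[OF this, of "inverse (\<bar>c\<bar> ^ DIM('a))"] show ?thesis
    using assms(1) by simp
qed

text \<open>Fubini for integrands that factor over the coordinates.\<close>

lemma has_bochner_integral_prod_Basis:
  fixes f :: "'a::euclidean_space \<Rightarrow> real \<Rightarrow> 'b::{real_normed_field, banach, second_countable_topology}"
  assumes "\<And>b. b \<in> Basis \<Longrightarrow> has_bochner_integral lborel (f b) (I b)"
  shows "has_bochner_integral lborel (\<lambda>x. \<Prod>b\<in>Basis. f b (x \<bullet> b)) (\<Prod>b\<in>Basis. I b)"
proof -
  interpret product_sigma_finite "\<lambda>_::'a. lborel :: real measure" ..
  have [measurable]: "f b \<in> borel_measurable borel" if "b \<in> Basis" for b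
    using assms[OF that] by (auto simp: has_bochner_integral_iff)
  have "has_bochner_integral (\<Pi>\<^sub>M b\<in>(Basis::'a set). lborel) (\<lambda>x. \<Prod>b\<in>Basis. f b (x b)) (\<Prod>b\<in>Basis. I b)"
    using assms by (auto simp: has_bochner_integral_iff product_integral_prod intro!: product_integrable_prod)
  then have "has_bochner_integral (\<Pi>\<^sub>M b\<in>(Basis::'a set). lborel)
      (\<lambda>x. \<Prod>b\<in>Basis. f b ((\<Sum>b\<in>Basis. x b *\<^sub>R b) \<bullet> b)) (\<Prod>b\<in>Basis. I b)"
    by (simp cong: prod.cong)
  then show ?thesis
    unfolding lborel_eq[where 'a='a]
  proof (rule has_bochner_integral_distr[rotated 2])
    show "(\<lambda>x. \<Prod>b\<in>Basis. f b (x \<bullet> b)) \<in> borel_measurable borel"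
      by (intro borel_measurable_prod) measurable
  qed measurable
qed

text \<open>The characteristic function of the standard normal distribution, rescaled by \<open>\<surd>(2 a)\<close>.\<close>

lemma has_bochner_integral_iexp_gaussian_real:
  fixes a t :: real
  assumes "0 < a"
  shows "has_bochner_integral lborel (\<lambda>x. iexp (t * x) * complex_of_real (exp (- (a * x\<^sup>2))))
    (complex_of_real (sqrt (pi / a) * exp (- (t\<^sup>2 / (4 * a)))))"
proof -
  \<comment> \<open>The substitution \<open>y = c x\<close> turns \<open>y\<^sup>2 / 2\<close> into \<open>a x\<^sup>2\<close>.\<close>
  define c where "c = sqrt (2 * a)"
  have c: "c > 0" "c\<^sup>2 = 2 * a" using assms by (auto simp: c_def)
  interpret prob_space std_normal_distribution
    by (rule prob_space_normal_density) simp
  have "integrable std_normal_distribution (\<lambda>x. iexp (t / c * x))"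
    by (rule integrable_iexp) auto
  moreover have "integral\<^sup>L std_normal_distribution (\<lambda>x. iexp (t / c * x)) = exp (- (t / c)\<^sup>2 / 2)"
    using fun_cong[OF char_std_normal_distribution, of "t / c"] by (simp add: char_def)
  ultimately have "has_bochner_integral std_normal_distribution (\<lambda>x. iexp (t / c * x))
      (complex_of_real (exp (- (t / c)\<^sup>2 / 2)))"
    by (simp add: has_bochner_integral_iff)
  then have "has_bochner_integral lborel (\<lambda>x. std_normal_density x *\<^sub>R iexp (t / c * x))
      (complex_of_real (exp (- (t / c)\<^sup>2 / 2)))"
    by (subst (asm) has_bochner_integral_density_iff) (simp_all add: normal_density_nonneg)
  from lborel_has_bochner_integral_scaleR[OF _ this, of c] c(1)
  have "has_bochner_integral lborel (\<lambda>x. std_normal_density (c * x) *\<^sub>R iexp (t * x))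
      (complex_of_real (exp (- (t / c)\<^sup>2 / 2)) /\<^sub>R c)"
    by simp
  from has_bochner_integral_scaleR_right[OF this, of "sqrt (2 * pi)"]
  have "has_bochner_integral lborel (\<lambda>x. sqrt (2 * pi) *\<^sub>R (std_normal_density (c * x) *\<^sub>R iexp (t * x)))
      (sqrt (2 * pi) *\<^sub>R (complex_of_real (exp (- (t / c)\<^sup>2 / 2)) /\<^sub>R c))" .
  moreover have "sqrt (2 * pi) *\<^sub>R (std_normal_density (c * x) *\<^sub>R iexp (t * x)) =
      iexp (t * x) * complex_of_real (exp (- (a * x\<^sup>2)))" for x
    by (simp add: std_normal_density_def power_mult_distrib c scaleR_conv_of_real)
  moreover have "sqrt (2 * pi) *\<^sub>R (complex_of_real (exp (- (t / c)\<^sup>2 / 2)) /\<^sub>R c) =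
      complex_of_real (sqrt (pi / a) * exp (- (t\<^sup>2 / (4 * a))))"
  proof -
    have "sqrt (2 * pi) / c = sqrt (pi / a)"
      unfolding c_def real_sqrt_divide[symmetric] by simp
    moreover have "- (t / c)\<^sup>2 / 2 = - (t\<^sup>2 / (4 * a))"
      by (simp add: power_divide c)
    moreover have "sqrt (2 * pi) *\<^sub>R (complex_of_real y /\<^sub>R c) = complex_of_real (sqrt (2 * pi) / c * y)" for y
      by (simp add: scaleR_conv_of_real field_simps)
    ultimately show ?thesis by (simp only:)
  qed
  ultimately show ?thesis by simp
qed

lemma has_bochner_integral_iexp_gaussian:
  fixes x :: "'a::euclidean_space"
  assumes "0 < a"
  shows "has_bochner_integral lborel
    (\<lambda>\<xi>. iexp (x \<bullet> \<xi>) * complex_of_real (exp (- (a * (norm \<xi>)\<^sup>2))))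
    (complex_of_real (sqrt (pi / a) ^ DIM('a) * exp (- ((norm x)\<^sup>2 / (4 * a)))))"
proof -
  have sq: "(norm y)\<^sup>2 = (\<Sum>b\<in>Basis. (y \<bullet> b)\<^sup>2)" for y :: 'a
    by (subst power2_norm_eq_inner, subst euclidean_inner) (simp add: power2_eq_square)
  have "has_bochner_integral lborel
      (\<lambda>\<xi>. \<Prod>b\<in>Basis. iexp ((x \<bullet> b) * (\<xi> \<bullet> b)) * complex_of_real (exp (- (a * (\<xi> \<bullet> b)\<^sup>2))))
      (\<Prod>b\<in>(Basis::'a set). complex_of_real (sqrt (pi / a) * exp (- ((x \<bullet> b)\<^sup>2 / (4 * a)))))"
    by (rule has_bochner_integral_prod_Basis[where
          f = "\<lambda>b y. iexp ((x \<bullet> b) * y) * complex_of_real (exp (- (a * y\<^sup>2)))"])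
      (rule has_bochner_integral_iexp_gaussian_real[OF assms])
  moreover have "(\<Prod>b\<in>Basis. iexp ((x \<bullet> b) * (\<xi> \<bullet> b)) * complex_of_real (exp (- (a * (\<xi> \<bullet> b)\<^sup>2)))) =
      iexp (x \<bullet> \<xi>) * complex_of_real (exp (- (a * (norm \<xi>)\<^sup>2)))" for \<xi> :: 'a
    unfolding sq euclidean_inner[of x \<xi>]
    by (simp add: prod.distrib exp_sum[symmetric] sum_distrib_left sum_negf flip: of_real_prod)
  moreover have "(\<Prod>b\<in>(Basis::'a set). complex_of_real (sqrt (pi / a) * exp (- ((x \<bullet> b)\<^sup>2 / (4 * a))))) =
      complex_of_real (sqrt (pi / a) ^ DIM('a) * exp (- ((norm x)\<^sup>2 / (4 * a))))"
    unfolding sq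
    by (simp add: prod.distrib exp_sum[symmetric] sum_divide_distrib sum_negf flip: of_real_prod)
  ultimately show ?thesis by simp
qed

lemma has_bochner_integral_gaussian:
  assumes "0 < a"
  shows "has_bochner_integral lborel (\<lambda>\<xi>::'a::euclidean_space. exp (- (a * (norm \<xi>)\<^sup>2)))
    (sqrt (pi / a) ^ DIM('a))"
  using has_bochner_integral_Re[OF has_bochner_integral_iexp_gaussian[OF assms, of "0::'a"]] by simp

section \<open>Positivity of the Fourier transform of a mixture\<close>

lemma nonneg_Reals_lim:
  fixes F :: "nat \<Rightarrow> complex"
  assumes "\<And>n. F n \<in> \<real>\<^sub>\<ge>\<^sub>0" "F \<longlonglongrightarrow> z"
  shows "z \<in> \<real>\<^sub>\<ge>\<^sub>0"
  by (rule closed_sequentially[OF closed_nonneg_Reals_complex]) (use assms in auto)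

lemma has_bochner_integral_complex_of_real_iff:
  "has_bochner_integral M (\<lambda>x. complex_of_real (f x)) (complex_of_real I) \<longleftrightarrow> has_bochner_integral M f I"
  by (simp add: has_bochner_integral_iff complex_of_real_integrable_eq)

lemma AE_lborel_norm_pos: "AE \<xi>::'a::euclidean_space in lborel. 0 < norm \<xi>"
  using AE_lborel_singleton[of "0::'a"] by simp

lemma gaussian_mixture_integrable:
  fixes x :: "'a::euclidean_space"
  assumes "gaussian_mixture f" "0 < e"
  shows "integrable lborel (\<lambda>\<xi>. iexp (x \<bullet> \<xi>) * complex_of_real (f ((norm \<xi>)\<^sup>2) * exp (- (e * (norm \<xi>)\<^sup>2))))"
proof -
  obtain B where B: "B \<ge> 0" "\<And>r. r > 0 \<Longrightarrow> \<bar>f r\<bar> \<le> B"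
    using gaussian_mixture_bounded[OF assms(1)] by blast
  have [measurable]: "f \<in> borel_measurable borel"
    by (rule gaussian_mixture_measurable[OF assms(1)])
  show ?thesis
  proof (rule Bochner_Integration.integrable_bound)
    show "integrable lborel (\<lambda>\<xi>::'a. B * exp (- (e * (norm \<xi>)\<^sup>2)))"
      using has_bochner_integral_gaussian[OF assms(2), where 'a = 'a]
      by (intro integrable_mult_right) (auto simp: has_bochner_integral_iff)
    show "AE \<xi>::'a in lborel. norm (iexp (x \<bullet> \<xi>) * complex_of_real (f ((norm \<xi>)\<^sup>2) * exp (- (e * (norm \<xi>)\<^sup>2))))
        \<le> norm (B * exp (- (e * (norm \<xi>)\<^sup>2)))"
      using AE_lborel_norm_pos
    proof eventually_elim
      case (elim \<xi>)
      then show ?case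
        using B(1) B(2)[of "(norm \<xi>)\<^sup>2"] by (simp add: norm_mult abs_mult mult_right_mono)
    qed
  qed measurable
qed

text \<open>A mixture need not be integrable over the frequency space, as the constants show. A Gaussian
  damping factor makes it so, and then all four ways of building a mixture keep the Fourier
  transform real and nonnegative.\<close>

lemma gaussian_mixture_fourier_damped_nonneg:
  fixes x :: "'a::euclidean_space"
  assumes "gaussian_mixture f" "0 < e"
  shows "(LINT \<xi>|lborel. iexp (x \<bullet> \<xi>) * complex_of_real (f ((norm \<xi>)\<^sup>2) * exp (- (e * (norm \<xi>)\<^sup>2)))) \<in> \<real>\<^sub>\<ge>\<^sub>0"
  using assms(1)
proof (induction rule: gaussian_mixture.induct)
  case (exp u)
  have "complex_of_real (exp (- (u * (norm \<xi>)\<^sup>2)) * exp (- (e * (norm \<xi>)\<^sup>2))) =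
      complex_of_real (exp (- ((u + e) * (norm \<xi>)\<^sup>2)))" for \<xi> :: 'a
    by (simp add: exp_add[symmetric] algebra_simps flip: of_real_mult)
  moreover have "(LINT \<xi>|lborel. iexp (x \<bullet> \<xi>) * complex_of_real (exp (- ((u + e) * (norm \<xi>)\<^sup>2)))) =
      complex_of_real (sqrt (pi / (u + e)) ^ DIM('a) * exp (- ((norm x)\<^sup>2 / (4 * (u + e)))))"
    using exp assms(2)
    by (intro has_bochner_integral_integral_eq has_bochner_integral_iexp_gaussian) auto
  moreover have "0 \<le> sqrt (pi / (u + e)) ^ DIM('a) * exp (- ((norm x)\<^sup>2 / (4 * (u + e))))"
    using exp assms(2) by auto
  ultimately show ?case by (simp only: nonneg_Reals_of_real_iff)
next
  case (scale c f)
  then show ?case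
    by (simp add: mult.left_commute[of _ "complex_of_real c"] mult.assoc nonneg_Reals_mult_I)
next
  case (add f g)
  then show ?case
    using gaussian_mixture_integrable[OF add.hyps(1) assms(2), of x]
      gaussian_mixture_integrable[OF add.hyps(2) assms(2), of x]
    by (simp add: distrib_left distrib_right nonneg_Reals_add_I)
next
  case (limit f B g)
  note [measurable] = gaussian_mixture_measurable[OF limit.hyps(1)] limit.hyps(4)
  have "(\<lambda>n. LINT \<xi>|lborel. iexp (x \<bullet> \<xi>) * complex_of_real (f n ((norm \<xi>)\<^sup>2) * exp (- (e * (norm \<xi>)\<^sup>2))))
      \<longlonglongrightarrow> (LINT \<xi>|lborel. iexp (x \<bullet> \<xi>) * complex_of_real (g ((norm \<xi>)\<^sup>2) * exp (- (e * (norm \<xi>)\<^sup>2))))"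
  proof (rule integral_dominated_convergence[where w = "\<lambda>\<xi>. B * exp (- (e * (norm \<xi>)\<^sup>2))"])
    show "integrable lborel (\<lambda>\<xi>::'a. B * exp (- (e * (norm \<xi>)\<^sup>2)))"
      using has_bochner_integral_gaussian[OF assms(2), where 'a = 'a]
      by (intro integrable_mult_right) (auto simp: has_bochner_integral_iff)
    show "AE \<xi>::'a in lborel. (\<lambda>n. iexp (x \<bullet> \<xi>) * complex_of_real (f n ((norm \<xi>)\<^sup>2) * exp (- (e * (norm \<xi>)\<^sup>2))))
        \<longlonglongrightarrow> iexp (x \<bullet> \<xi>) * complex_of_real (g ((norm \<xi>)\<^sup>2) * exp (- (e * (norm \<xi>)\<^sup>2)))"
      using AE_lborel_norm_pos
      by eventually_elim (auto intro!: tendsto_intros limit.hyps(3))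
    show "AE \<xi>::'a in lborel. norm (iexp (x \<bullet> \<xi>) * complex_of_real (f n ((norm \<xi>)\<^sup>2) * exp (- (e * (norm \<xi>)\<^sup>2))))
        \<le> B * exp (- (e * (norm \<xi>)\<^sup>2))" for n
      using AE_lborel_norm_pos
    proof eventually_elim
      case (elim \<xi>)
      then show ?case
        using limit.hyps(2)[of "(norm \<xi>)\<^sup>2" n] by (simp add: norm_mult mult_right_mono)
    qed
  qed measurable
  with limit.IH show ?case
    by (rule nonneg_Reals_lim)
qed

lemma gaussian_mixture_fourier_nonneg:
  fixes x :: "'a::euclidean_space"
  assumes f: "gaussian_mixture f" and int: "integrable lborel (\<lambda>\<xi>::'a. f ((norm \<xi>)\<^sup>2))"
  shows "(LINT \<xi>|lborel. iexp (x \<bullet> \<xi>) * complex_of_real (f ((norm \<xi>)\<^sup>2))) \<in> \<real>\<^sub>\<ge>\<^sub>0"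
proof -
  note [measurable] = gaussian_mixture_measurable[OF f]
  define e where "e n = 1 / real (Suc n)" for n
  have e: "e n > 0" for n by (simp add: e_def)
  have "e \<longlonglongrightarrow> 0" unfolding e_def by real_asymp
  have "(\<lambda>n. LINT \<xi>|lborel. iexp (x \<bullet> \<xi>) * complex_of_real (f ((norm \<xi>)\<^sup>2) * exp (- (e n * (norm \<xi>)\<^sup>2))))
      \<longlonglongrightarrow> (LINT \<xi>|lborel. iexp (x \<bullet> \<xi>) * complex_of_real (f ((norm \<xi>)\<^sup>2)))"
  proof (rule integral_dominated_convergence[where w = "\<lambda>\<xi>. \<bar>f ((norm \<xi>)\<^sup>2)\<bar>"])
    show "integrable lborel (\<lambda>\<xi>::'a. \<bar>f ((norm \<xi>)\<^sup>2)\<bar>)"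
      using int by simp
    show "AE \<xi>::'a in lborel. (\<lambda>n. iexp (x \<bullet> \<xi>) * complex_of_real (f ((norm \<xi>)\<^sup>2) * exp (- (e n * (norm \<xi>)\<^sup>2))))
        \<longlonglongrightarrow> iexp (x \<bullet> \<xi>) * complex_of_real (f ((norm \<xi>)\<^sup>2))"
    proof (intro AE_I2)
      fix \<xi> :: 'a
      have "(\<lambda>n. f ((norm \<xi>)\<^sup>2) * exp (- (e n * (norm \<xi>)\<^sup>2))) \<longlonglongrightarrow> f ((norm \<xi>)\<^sup>2) * exp (- (0 * (norm \<xi>)\<^sup>2))"
        by (intro tendsto_intros \<open>e \<longlonglongrightarrow> 0\<close>)
      then show "(\<lambda>n. iexp (x \<bullet> \<xi>) * complex_of_real (f ((norm \<xi>)\<^sup>2) * exp (- (e n * (norm \<xi>)\<^sup>2))))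
        \<longlonglongrightarrow> iexp (x \<bullet> \<xi>) * complex_of_real (f ((norm \<xi>)\<^sup>2))"
        by (intro tendsto_intros) simp
    qed
    show "AE \<xi>::'a in lborel. norm (iexp (x \<bullet> \<xi>) * complex_of_real (f ((norm \<xi>)\<^sup>2) * exp (- (e n * (norm \<xi>)\<^sup>2))))
        \<le> \<bar>f ((norm \<xi>)\<^sup>2)\<bar>" for n
      using e[of n] by (intro AE_I2) (simp add: norm_mult mult_left_le)
  qed measurable
  then show ?thesis
    by (rule nonneg_Reals_lim[rotated]) (rule gaussian_mixture_fourier_damped_nonneg[OF f e])
qed

section \<open>The total mass of a nonnegative Fourier transform\<close>

text \<open>Fubini moves the Gaussian weight from the transform \<open>F\<close> of \<open>\<phi>\<close> to \<open>\<phi>\<close> itself, and the substitution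
  \<open>\<xi> = 2 \<surd>e \<eta>\<close> puts the result in a form whose limit as \<open>e \<rightarrow> 0\<close> is visible. Integrability of \<open>F\<close> is
  not needed, as \<open>F\<close> is bounded.\<close>

lemma has_bochner_integral_fourier_damped:
  fixes \<phi> :: "'a::euclidean_space \<Rightarrow> real"
  assumes int: "integrable lborel \<phi>" and "0 < e"
  defines "F \<equiv> \<lambda>x. LINT \<xi>|lborel. iexp (x \<bullet> \<xi>) * complex_of_real (\<phi> \<xi>)"
  shows "has_bochner_integral lborel (\<lambda>x. F x * complex_of_real (exp (- (e * (norm x)\<^sup>2))))
    (complex_of_real ((2 * sqrt pi) ^ DIM('a) *
      (LINT \<eta>|lborel. \<phi> ((2 * sqrt e) *\<^sub>R \<eta>) * exp (- (norm \<eta>)\<^sup>2))))"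
proof -
  have [measurable]: "\<phi> \<in> borel_measurable borel" using int by auto
  have G: "integrable lborel (\<lambda>x::'a. exp (- (e * (norm x)\<^sup>2)))"
    using has_bochner_integral_gaussian[OF \<open>0 < e\<close>, where 'a = 'a] by (auto simp: has_bochner_integral_iff)
  let ?h = "\<lambda>x \<xi>. iexp (x \<bullet> \<xi>) * complex_of_real (\<phi> \<xi>) * complex_of_real (exp (- (e * (norm x)\<^sup>2)))"
  have h: "integrable (lborel \<Otimes>\<^sub>M lborel) (\<lambda>(x, \<xi>). ?h x \<xi>)"
  proof (rule lborel_pair.Fubini_integrable)
    have "(LINT \<xi>|lborel. norm (?h x \<xi>)) = exp (- (e * (norm x)\<^sup>2)) * (LINT \<xi>|lborel. \<bar>\<phi> \<xi>\<bar>)" for x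
      by (simp add: norm_mult)
    then show "integrable lborel (\<lambda>x. LINT \<xi>|lborel. norm (case (x, \<xi>) of (x, \<xi>) \<Rightarrow> ?h x \<xi>))"
      using G by simp
    show "AE x in lborel. integrable lborel (\<lambda>\<xi>. case (x, \<xi>) of (x, \<xi>) \<Rightarrow> ?h x \<xi>)"
    proof (intro AE_I2)
      fix x :: 'a
      have "integrable lborel (\<lambda>\<xi>. ?h x \<xi>)"
        by (rule Bochner_Integration.integrable_bound[OF integrable_mult_left[OF int, of "exp (- (e * (norm x)\<^sup>2))"]])
          (auto simp: norm_mult abs_mult)
      then show "integrable lborel (\<lambda>\<xi>. case (x, \<xi>) of (x, \<xi>) \<Rightarrow> ?h x \<xi>)" by simp
    qed
  qed measurable
  have inner: "F x * complex_of_real (exp (- (e * (norm x)\<^sup>2))) = (LINT \<xi>|lborel. ?h x \<xi>)" for x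
    unfolding F_def by simp
  have swap: "(LINT \<xi>|lborel. (LINT x|lborel. ?h x \<xi>)) = (LINT x|lborel. (LINT \<xi>|lborel. ?h x \<xi>))"
    using lborel_pair.Fubini_integral[of "\<lambda>x \<xi>. ?h x \<xi>"] h by simp
  have outer: "(LINT x|lborel. ?h x \<xi>) = complex_of_real
      (sqrt (pi / e) ^ DIM('a) * (\<phi> \<xi> * exp (- ((norm \<xi>)\<^sup>2 / (4 * e)))))" for \<xi>
  proof -
    have "(LINT x|lborel. ?h x \<xi>) =
        complex_of_real (\<phi> \<xi>) * (LINT x|lborel. iexp (\<xi> \<bullet> x) * complex_of_real (exp (- (e * (norm x)\<^sup>2))))"
      by (subst integral_mult_right_zero[symmetric]) (simp add: inner_commute mult_ac)
    also have "(LINT x|lborel. iexp (\<xi> \<bullet> x) * complex_of_real (exp (- (e * (norm x)\<^sup>2)))) =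
        complex_of_real (sqrt (pi / e) ^ DIM('a) * exp (- ((norm \<xi>)\<^sup>2 / (4 * e))))"
      by (intro has_bochner_integral_integral_eq has_bochner_integral_iexp_gaussian \<open>0 < e\<close>)
    finally show ?thesis by simp
  qed
  have "integrable lborel (\<lambda>\<xi>. \<phi> \<xi> * exp (- ((norm \<xi>)\<^sup>2 / (4 * e))))"
    using \<open>0 < e\<close> by (intro Bochner_Integration.integrable_bound[OF int]) (auto simp: abs_mult mult_left_le)
  from lborel_has_bochner_integral_scaleR[OF _ has_bochner_integral_integrable[OF this], of "2 * sqrt e"]
  have "(LINT \<eta>::'a|lborel. \<phi> ((2 * sqrt e) *\<^sub>R \<eta>) * exp (- ((norm ((2 * sqrt e) *\<^sub>R \<eta>))\<^sup>2 / (4 * e)))) =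
      (LINT \<xi>|lborel. \<phi> \<xi> * exp (- ((norm \<xi>)\<^sup>2 / (4 * e)))) /\<^sub>R \<bar>2 * sqrt e\<bar> ^ DIM('a)"
    using \<open>0 < e\<close> by (intro has_bochner_integral_integral_eq) simp
  moreover have "(norm ((2 * sqrt e) *\<^sub>R \<eta>))\<^sup>2 / (4 * e) = (norm \<eta>)\<^sup>2" for \<eta> :: 'a
    using \<open>0 < e\<close> by (simp add: power_mult_distrib)
  moreover have "\<bar>2 * sqrt e\<bar> = 2 * sqrt e"
    using \<open>0 < e\<close> by simp
  ultimately have "(LINT \<eta>|lborel. \<phi> ((2 * sqrt e) *\<^sub>R \<eta>) * exp (- (norm \<eta>)\<^sup>2)) =
      (LINT \<xi>|lborel. \<phi> \<xi> * exp (- ((norm \<xi>)\<^sup>2 / (4 * e)))) /\<^sub>R (2 * sqrt e) ^ DIM('a)"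
    by (simp only:)
  moreover have "(2 * sqrt e) ^ DIM('a) \<noteq> 0"
    using \<open>0 < e\<close> by simp
  ultimately have subst: "(LINT \<xi>|lborel. \<phi> \<xi> * exp (- ((norm \<xi>)\<^sup>2 / (4 * e)))) =
      (2 * sqrt e) ^ DIM('a) * (LINT \<eta>|lborel. \<phi> ((2 * sqrt e) *\<^sub>R \<eta>) * exp (- (norm \<eta>)\<^sup>2))"
    by (simp only: real_scaleR_def mult.assoc[symmetric] right_inverse mult_1_left not_False_eq_True)
  have "(LINT x|lborel. (LINT \<xi>|lborel. ?h x \<xi>)) = complex_of_real
      (sqrt (pi / e) ^ DIM('a) * (LINT \<xi>|lborel. \<phi> \<xi> * exp (- ((norm \<xi>)\<^sup>2 / (4 * e)))))"
    unfolding swap[symmetric] outer by (simp only: integral_complex_of_real integral_mult_right_zero)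
  also have "sqrt (pi / e) ^ DIM('a) * (LINT \<xi>|lborel. \<phi> \<xi> * exp (- ((norm \<xi>)\<^sup>2 / (4 * e)))) =
      (sqrt (pi / e) * (2 * sqrt e)) ^ DIM('a) * (LINT \<eta>|lborel. \<phi> ((2 * sqrt e) *\<^sub>R \<eta>) * exp (- (norm \<eta>)\<^sup>2))"
    unfolding subst power_mult_distrib by (simp only: mult.assoc)
  also have "sqrt (pi / e) * (2 * sqrt e) = 2 * sqrt pi"
    using \<open>0 < e\<close> by (simp add: real_sqrt_divide)
  finally show ?thesis
    unfolding inner has_bochner_integral_iff
    using lborel_pair.integrable_fst'[OF h] by simp
qed

text \<open>A nonnegative Fourier transform of a bounded integrable function that is continuous at the
  origin is automatically integrable, and inversion holds at the origin: the damped integrals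
  converge to \<open>(2\<pi>)\<^sup>n \<phi>(0)\<close> by dominated convergence, and to the integral of \<open>F\<close> by monotone
  convergence.\<close>

theorem has_bochner_integral_nonneg_fourier:
  fixes \<phi> :: "'a::euclidean_space \<Rightarrow> real"
  assumes int: "integrable lborel \<phi>" and bounded: "\<And>\<xi>. \<bar>\<phi> \<xi>\<bar> \<le> B" and cont: "isCont \<phi> 0"
  defines "F \<equiv> \<lambda>x. LINT \<xi>|lborel. iexp (x \<bullet> \<xi>) * complex_of_real (\<phi> \<xi>)"
  assumes nonneg: "\<And>x. F x \<in> \<real>\<^sub>\<ge>\<^sub>0"
  shows "has_bochner_integral lborel F (complex_of_real ((2 * pi) ^ DIM('a) * \<phi> 0))"
proof -
  have [measurable]: "\<phi> \<in> borel_measurable borel" using int by auto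
  have [measurable]: "F \<in> borel_measurable borel" unfolding F_def by measurable
  define f where "f x = Re (F x)" for x
  have [measurable]: "f \<in> borel_measurable borel" unfolding f_def by measurable
  have F: "F x = complex_of_real (f x)" and f_nonneg: "0 \<le> f x" for x
    using nonneg[of x] by (auto simp: f_def complex_nonneg_Reals_iff complex_eq_iff)
  have FI: "(LINT \<xi>|lborel. iexp (x \<bullet> \<xi>) * complex_of_real (\<phi> \<xi>)) = complex_of_real (f x)" for x
    using F[of x] by (simp only: F_def)
  define e where "e n = 1 / real (Suc n)" for n
  have e: "e n > 0" for n by (simp add: e_def)
  have "e \<longlonglongrightarrow> 0" unfolding e_def by real_asymp
  have damped: "has_bochner_integral lborel (\<lambda>x. f x * exp (- (e n * (norm x)\<^sup>2)))
      ((2 * sqrt pi) ^ DIM('a) * (LINT \<eta>|lborel. \<phi> ((2 * sqrt (e n)) *\<^sub>R \<eta>) * exp (- (norm \<eta>)\<^sup>2)))" for n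
    using has_bochner_integral_fourier_damped[OF int e[of n]]
    by (simp only: FI of_real_mult[symmetric] has_bochner_integral_complex_of_real_iff)
  have gauss: "has_bochner_integral lborel (\<lambda>\<eta>::'a. exp (- (norm \<eta>)\<^sup>2)) (sqrt pi ^ DIM('a))"
    using has_bochner_integral_gaussian[of 1, where 'a='a] by simp
  have "(\<lambda>n. LINT \<eta>|lborel. \<phi> ((2 * sqrt (e n)) *\<^sub>R \<eta>) * exp (- (norm \<eta>)\<^sup>2))
      \<longlonglongrightarrow> (LINT \<eta>::'a|lborel. \<phi> 0 * exp (- (norm \<eta>)\<^sup>2))"
  proof (rule integral_dominated_convergence[where w = "\<lambda>\<eta>. B * exp (- (norm \<eta>)\<^sup>2)"])
    show "integrable lborel (\<lambda>\<eta>::'a. B * exp (- (norm \<eta>)\<^sup>2))"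
      using gauss by (intro integrable_mult_right) (auto simp: has_bochner_integral_iff)
    show "AE \<eta>::'a in lborel. (\<lambda>n. \<phi> ((2 * sqrt (e n)) *\<^sub>R \<eta>) * exp (- (norm \<eta>)\<^sup>2)) \<longlonglongrightarrow> \<phi> 0 * exp (- (norm \<eta>)\<^sup>2)"
    proof (intro AE_I2 tendsto_mult tendsto_const isCont_tendsto_compose[OF cont])
      fix \<eta> :: 'a
      have "(\<lambda>n. (2 * sqrt (e n)) *\<^sub>R \<eta>) \<longlonglongrightarrow> (2 * sqrt 0) *\<^sub>R \<eta>"
        by (intro tendsto_intros \<open>e \<longlonglongrightarrow> 0\<close>)
      then show "(\<lambda>n. (2 * sqrt (e n)) *\<^sub>R \<eta>) \<longlonglongrightarrow> 0" by simp
    qed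
    show "AE \<eta>::'a in lborel. norm (\<phi> ((2 * sqrt (e n)) *\<^sub>R \<eta>) * exp (- (norm \<eta>)\<^sup>2)) \<le> B * exp (- (norm \<eta>)\<^sup>2)" for n
      using bounded by (intro AE_I2) (simp add: abs_mult mult_right_mono)
  qed measurable
  also have "(LINT \<eta>::'a|lborel. \<phi> 0 * exp (- (norm \<eta>)\<^sup>2)) = \<phi> 0 * sqrt pi ^ DIM('a)"
    using gauss by (simp add: has_bochner_integral_iff)
  finally have "(\<lambda>n. (2 * sqrt pi) ^ DIM('a) * (LINT \<eta>|lborel. \<phi> ((2 * sqrt (e n)) *\<^sub>R \<eta>) * exp (- (norm \<eta>)\<^sup>2)))
      \<longlonglongrightarrow> (2 * sqrt pi) ^ DIM('a) * (\<phi> 0 * sqrt pi ^ DIM('a))"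
    by (rule tendsto_mult_left)
  also have "(2 * sqrt pi) ^ DIM('a) * (\<phi> 0 * sqrt pi ^ DIM('a)) = (2 * sqrt pi * sqrt pi) ^ DIM('a) * \<phi> 0"
    by (simp only: power_mult_distrib mult_ac)
  also have "2 * sqrt pi * sqrt pi = 2 * pi" by simp
  finally have lim: "(\<lambda>n. LINT x|lborel. f x * exp (- (e n * (norm x)\<^sup>2))) \<longlonglongrightarrow> (2 * pi) ^ DIM('a) * \<phi> 0"
    using damped by (simp add: has_bochner_integral_iff)
  have "has_bochner_integral lborel f ((2 * pi) ^ DIM('a) * \<phi> 0)"
  proof (rule has_bochner_integral_monotone_convergence[OF _ _ _ lim])
    show "integrable lborel (\<lambda>x. f x * exp (- (e n * (norm x)\<^sup>2)))" for n
      using damped by (simp add: has_bochner_integral_iff)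
    show "AE x in lborel. mono (\<lambda>n. f x * exp (- (e n * (norm x)\<^sup>2)))"
      unfolding e_def
      by (intro AE_I2 monoI mult_left_mono f_nonneg)
        (auto intro!: divide_left_mono mult_right_mono simp: field_simps)
    show "AE x in lborel. (\<lambda>n. f x * exp (- (e n * (norm x)\<^sup>2))) \<longlonglongrightarrow> f x"
    proof (intro AE_I2)
      fix x :: 'a
      have "(\<lambda>n. f x * exp (- (e n * (norm x)\<^sup>2))) \<longlonglongrightarrow> f x * exp (- (0 * (norm x)\<^sup>2))"
        by (intro tendsto_intros \<open>e \<longlonglongrightarrow> 0\<close>)
      then show "(\<lambda>n. f x * exp (- (e n * (norm x)\<^sup>2))) \<longlonglongrightarrow> f x" by simp
    qed
  qed measurable
  then show ?thesis
    unfolding F has_bochner_integral_complex_of_real_iff by simp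
qed

section \<open>Stretched exponentials\<close>

lemma integrable_inverse_1_plus_square_lborel:
  "integrable lborel (\<lambda>x::real. inverse (1 + x\<^sup>2))"
  using integrable_inverse_1_plus_square
  by (simp add: set_integrable_def einterval_def)

lemma stretched_exp_le:
  fixes A s :: real and m :: nat
  assumes "0 < A" "0 < s"
  shows "\<exists>B\<ge>0. \<forall>r\<ge>0. exp (- A * r powr (2 * s)) * (1 + r\<^sup>2) ^ m \<le> B"
proof -
  have "((\<lambda>r. exp (- A * r powr (2 * s)) * (1 + r\<^sup>2) powr real m) \<longlongrightarrow> 0) at_top"
    using assms by real_asymp
  moreover have "(1 + r\<^sup>2) powr real m = (1 + r\<^sup>2) ^ m" for r :: real
    by (intro powr_realpow) (simp add: add_pos_nonneg)
  ultimately have "((\<lambda>r. exp (- A * r powr (2 * s)) * (1 + r\<^sup>2) ^ m) \<longlongrightarrow> 0) at_top"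
    by simp
  then have "\<forall>\<^sub>F r in at_top. exp (- A * r powr (2 * s)) * (1 + r\<^sup>2) ^ m < 1"
    by (rule order_tendstoD) simp
  then obtain N where N: "\<And>r. r \<ge> N \<Longrightarrow> exp (- A * r powr (2 * s)) * (1 + r\<^sup>2) ^ m < 1"
    by (auto simp: eventually_at_top_linorder)
  show ?thesis
  proof (intro exI[of _ "1 + (1 + N\<^sup>2) ^ m"] conjI allI impI)
    fix r :: real assume "0 \<le> r"
    have *: "0 \<le> (1 + N\<^sup>2) ^ m" by simp
    show "exp (- A * r powr (2 * s)) * (1 + r\<^sup>2) ^ m \<le> 1 + (1 + N\<^sup>2) ^ m"
    proof (cases "r \<ge> N")
      case True
      then show ?thesis using N[OF True] * by linarith
    next
      case False
      have "exp (- A * r powr (2 * s)) * (1 + r\<^sup>2) ^ m \<le> 1 * (1 + N\<^sup>2) ^ m"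
        using False \<open>0 \<le> r\<close> assms by (intro mult_mono power_mono add_mono) auto
      then show ?thesis by simp
    qed
  qed simp
qed

lemma integrable_stretched_exp:
  assumes "0 < A" "0 < s"
  shows "integrable lborel (\<lambda>\<xi>::'a::euclidean_space. exp (- A * norm \<xi> powr (2 * s)))"
proof -
  obtain B where B: "B \<ge> 0" "\<And>r. r \<ge> 0 \<Longrightarrow> exp (- A * r powr (2 * s)) * (1 + r\<^sup>2) ^ DIM('a) \<le> B"
    using stretched_exp_le[OF assms, of "DIM('a)"] by blast
  have "has_bochner_integral lborel (\<lambda>\<xi>::'a. \<Prod>b\<in>Basis. inverse (1 + (\<xi> \<bullet> b)\<^sup>2))
      (\<Prod>b\<in>(Basis::'a set). LINT x|lborel. inverse (1 + x\<^sup>2))"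
    by (rule has_bochner_integral_prod_Basis)
      (rule has_bochner_integral_integrable[OF integrable_inverse_1_plus_square_lborel])
  then have int: "integrable lborel (\<lambda>\<xi>::'a. B * (\<Prod>b\<in>Basis. inverse (1 + (\<xi> \<bullet> b)\<^sup>2)))"
    by (intro integrable_mult_right) (auto simp: has_bochner_integral_iff)
  show ?thesis
  proof (rule Bochner_Integration.integrable_bound[OF int])
    show "AE \<xi>::'a in lborel. norm (exp (- A * norm \<xi> powr (2 * s)))
        \<le> norm (B * (\<Prod>b\<in>Basis. inverse (1 + (\<xi> \<bullet> b)\<^sup>2)))"
    proof (intro AE_I2)
      fix \<xi> :: 'a
      \<comment> \<open>Compare with the integrable product of the functions \<open>1 / (1 + x\<^sub>b\<^sup>2)\<close>, which is at least
          \<open>(1 + |\<xi>|\<^sup>2)\<close> to the power minus the dimension.\<close>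
      have pos: "0 < 1 + (norm \<xi>)\<^sup>2" "0 < 1 + (\<xi> \<bullet> b)\<^sup>2" for b
        by (auto simp: add_pos_nonneg)
      have "(\<xi> \<bullet> b)\<^sup>2 \<le> (norm \<xi>)\<^sup>2" if "b \<in> Basis" for b
        using Basis_le_norm[OF that, of \<xi>] by (metis abs_le_square_iff abs_norm_cancel)
      then have "inverse (1 + (norm \<xi>)\<^sup>2) \<le> inverse (1 + (\<xi> \<bullet> b)\<^sup>2)" if "b \<in> Basis" for b
        using that pos(2) by (intro le_imp_inverse_le) auto
      then have "(\<Prod>b\<in>(Basis::'a set). inverse (1 + (norm \<xi>)\<^sup>2)) \<le> (\<Prod>b\<in>Basis. inverse (1 + (\<xi> \<bullet> b)\<^sup>2))"
        by (intro prod_mono conjI) auto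
      then have le: "inverse ((1 + (norm \<xi>)\<^sup>2) ^ DIM('a)) \<le> (\<Prod>b\<in>Basis. inverse (1 + (\<xi> \<bullet> b)\<^sup>2))"
        by (simp add: power_inverse)
      have "exp (- A * norm \<xi> powr (2 * s)) \<le> B * inverse ((1 + (norm \<xi>)\<^sup>2) ^ DIM('a))"
        using B(2)[of "norm \<xi>"] pos(1) by (simp add: divide_inverse[symmetric] pos_le_divide_eq)
      also have "\<dots> \<le> B * (\<Prod>b\<in>Basis. inverse (1 + (\<xi> \<bullet> b)\<^sup>2))"
        by (intro mult_left_mono le B(1))
      finally show "norm (exp (- A * norm \<xi> powr (2 * s)))
          \<le> norm (B * (\<Prod>b\<in>Basis. inverse (1 + (\<xi> \<bullet> b)\<^sup>2)))"
        by simp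
    qed
  qed measurable
qed

lemma integral_stretched_exp_pos:
  assumes "0 < A" "0 < s"
  shows "0 < (LINT \<xi>::'a::euclidean_space|lborel. exp (- A * norm \<xi> powr (2 * s)))"
proof -
  have "(LINT \<xi>::'a|lborel. exp (- A * norm \<xi> powr (2 * s))) \<noteq> 0"
    by (subst integral_nonneg_eq_0_iff_AE[OF integrable_stretched_exp[OF assms]])
      (auto simp: AE_iff_measurable[of UNIV])
  moreover have "0 \<le> (LINT \<xi>::'a|lborel. exp (- A * norm \<xi> powr (2 * s)))" by simp
  ultimately show ?thesis by linarith
qed

lemma integral_stretched_exp_scale:
  assumes "0 < A" "0 < s"
  shows "(LINT \<xi>::'a::euclidean_space|lborel. exp (- A * norm \<xi> powr (2 * s))) =
    A powr (- (real DIM('a) / (2 * s))) * (LINT \<xi>::'a|lborel. exp (- (norm \<xi> powr (2 * s))))"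
proof -
  \<comment> \<open>The dilation by \<open>c\<close> multiplies \<open>|\<xi>|\<^sup>2\<^sup>s\<close> by \<open>A\<close>.\<close>
  define c where "c = A powr (1 / (2 * s))"
  have c: "0 < c" using assms by (simp add: c_def)
  have "integrable lborel (\<lambda>\<xi>::'a. exp (- (norm \<xi> powr (2 * s))))"
    using integrable_stretched_exp[of 1 s] assms by simp
  from lborel_has_bochner_integral_scaleR[OF _ has_bochner_integral_integrable[OF this], of c] c
  have "(LINT \<xi>::'a|lborel. exp (- (norm (c *\<^sub>R \<xi>) powr (2 * s)))) =
      (LINT \<xi>::'a|lborel. exp (- (norm \<xi> powr (2 * s)))) /\<^sub>R \<bar>c\<bar> ^ DIM('a)"
    by (intro has_bochner_integral_integral_eq) simp
  moreover have "norm (c *\<^sub>R \<xi>) powr (2 * s) = A * norm \<xi> powr (2 * s)" for \<xi> :: 'a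
    using assms c by (simp add: powr_mult) (simp add: c_def powr_powr)
  moreover have "\<bar>c\<bar> ^ DIM('a) = A powr (real DIM('a) / (2 * s))"
    using assms c powr_realpow[OF c, of "DIM('a)"] by (simp add: c_def powr_powr)
  ultimately show ?thesis
    by (simp add: powr_minus)
qed

theorem has_bochner_integral_fourier_stretched_exp:
  assumes "0 < A" "0 < s" "s \<le> 1"
  shows "has_bochner_integral lborel
    (\<lambda>x::'a::euclidean_space. LINT \<xi>|lborel. iexp (x \<bullet> \<xi>) * complex_of_real (exp (- A * norm \<xi> powr (2 * s))))
    (complex_of_real ((2 * pi) ^ DIM('a)))"
proof -
  let ?f = "\<lambda>r. exp (- A * r powr s)"
  have eq: "exp (- A * norm \<xi> powr (2 * s)) = ?f ((norm \<xi>)\<^sup>2)" for \<xi> :: 'a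
    by (simp add: powr_powr flip: powr_numeral)
  have "has_bochner_integral lborel
    (\<lambda>x::'a. LINT \<xi>|lborel. iexp (x \<bullet> \<xi>) * complex_of_real (exp (- A * norm \<xi> powr (2 * s))))
    (complex_of_real ((2 * pi) ^ DIM('a) * exp (- A * norm (0::'a) powr (2 * s))))"
  proof (rule has_bochner_integral_nonneg_fourier[where B = 1])
    show "integrable lborel (\<lambda>\<xi>::'a. exp (- A * norm \<xi> powr (2 * s)))"
      by (rule integrable_stretched_exp[OF assms(1,2)])
    show "\<bar>exp (- A * norm \<xi> powr (2 * s))\<bar> \<le> 1" for \<xi> :: 'a
      using assms by simp
    show "isCont (\<lambda>\<xi>::'a. exp (- A * norm \<xi> powr (2 * s))) 0"
      using assms unfolding isCont_def
      by (intro tendsto_intros tendsto_powr') (auto intro!: tendsto_eq_intros)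
    show "(LINT \<xi>|lborel. iexp (x \<bullet> \<xi>) * complex_of_real (exp (- A * norm \<xi> powr (2 * s)))) \<in> \<real>\<^sub>\<ge>\<^sub>0"
      for x :: 'a
      unfolding eq
    proof (rule gaussian_mixture_fourier_nonneg)
      show "gaussian_mixture ?f"
        by (rule gaussian_mixture_stretched_exp[OF assms(2,3,1)])
      show "integrable lborel (\<lambda>\<xi>::'a. ?f ((norm \<xi>)\<^sup>2))"
        using integrable_stretched_exp[OF assms(1,2), where 'a='a] unfolding eq .
    qed
  qed
  then show ?thesis using assms by simp
qed

section \<open>The beam\<close>

lemma spread_eq:
  assumes "0 < s" "0 < z"
  shows "spread d s z = d / (2 * s + 1) * z powr (2 * s + 1)"
proof -
  let ?g = "\<lambda>r. \<bar>z - r\<bar> powr (2 * s)"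
  have cont: "continuous_on {0..z} ?g"
    using assms by (intro continuous_on_powr' continuous_intros) auto
  then have "set_integrable lborel {0..z} ?g"
    unfolding set_integrable_def by (intro borel_integrable_compact) auto
  then have "(LBINT r:{0..z}. ?g r) = integral {0..z} ?g"
    by (rule set_borel_integral_eq_integral)
  also have "\<dots> = z powr (2 * s + 1) / (2 * s + 1)"
  proof (rule integral_unique)
    let ?G = "\<lambda>r. - ((z - r) powr (2 * s + 1) / (2 * s + 1))"
    have "(?g has_integral (?G z - ?G 0)) {0..z}"
    \<comment> \<open>At the endpoint \<open>r = z\<close>, where the base of the power vanishes, continuity of the
        antiderivative is enough.\<close>
    proof (rule fundamental_theorem_of_calculus_interior)
      show "continuous_on {0..z} ?G"
        using assms by (intro continuous_intros continuous_on_powr') auto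
      show "(?G has_vector_derivative ?g r) (at r)" if "r \<in> {0<..<z}" for r
      proof -
        define k where "k = 2 * s + 1"
        have "k \<noteq> 0" using assms by (simp add: k_def)
        have "((\<lambda>r. - ((z - r) powr k / k)) has_real_derivative (z - r) powr (k - 1)) (at r)"
          using that \<open>k \<noteq> 0\<close> by (auto intro!: derivative_eq_intros)
        then show ?thesis
          using that unfolding has_real_derivative_iff_has_vector_derivative[symmetric]
          by (simp add: k_def)
      qed
    qed (use assms in auto)
    then show "(?g has_integral z powr (2 * s + 1) / (2 * s + 1)) {0..z}"
      using assms by simp
  qed
  finally show ?thesis by (simp add: spread_def)
qed

lemma spread_pos: "0 < d \<Longrightarrow> 0 < s \<Longrightarrow> 0 < z \<Longrightarrow> 0 < spread d s z"
  by (simp add: spread_eq)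

lemma beam_mass:
  assumes "0 < d" "0 < s" "s \<le> 1" "0 < z"
  shows "has_bochner_integral lborel (\<lambda>x. beam C d lam s x z) (complex_of_real (C * exp (- lam * z)))"
proof -
  have "has_bochner_integral lborel (\<lambda>x. beam C d lam s x z)
      (complex_of_real (C * exp (- lam * z)) * complex_of_real (1 / (4 * pi\<^sup>2)) *
        complex_of_real ((2 * pi) ^ DIM(real ^ 2)))"
    unfolding beam_def
    by (intro has_bochner_integral_mult_right has_bochner_integral_fourier_stretched_exp
        spread_pos assms)
  then show ?thesis by (simp add: power_mult_distrib)
qed

text \<open>The integral over the plane of the transverse profile in frequency with unit spread; it is the
  factor in the on-axis density that depends on the exponent alone.\<close>

definition stretched_exp_mass :: "real \<Rightarrow> real" where
  "stretched_exp_mass s = (LINT \<xi>::real ^ 2|lborel. exp (- (norm \<xi> powr (2 * s))))"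

lemma stretched_exp_mass_pos: "0 < s \<Longrightarrow> 0 < stretched_exp_mass s"
  using integral_stretched_exp_pos[of 1 s, where 'a = "real ^ 2"] by (simp add: stretched_exp_mass_def)

lemma beam_axis:
  assumes "0 < d" "0 < s" "0 < z"
  shows "beam C d lam s 0 z = complex_of_real (C * exp (- lam * z) *
    (stretched_exp_mass s * (d / (2 * s + 1)) powr (- (1 / s)) * z powr (- (2 + 1 / s)) / (4 * pi\<^sup>2)))"
proof -
  have "(LINT \<xi>::real ^ 2|lborel. exp (- spread d s z * norm \<xi> powr (2 * s))) =
      spread d s z powr (- (1 / s)) * stretched_exp_mass s"
    using integral_stretched_exp_scale[OF spread_pos[OF assms] assms(2), where 'a = "real ^ 2"]
    by (simp add: stretched_exp_mass_def)
  also have "spread d s z powr (- (1 / s)) =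
      (d / (2 * s + 1)) powr (- (1 / s)) * (z powr (2 * s + 1)) powr (- (1 / s))"
    unfolding spread_eq[OF assms(2,3)] using assms by (intro powr_mult)
  also have "(z powr (2 * s + 1)) powr (- (1 / s)) = z powr (- (2 + 1 / s))"
    using assms by (simp add: powr_powr field_simps)
  finally show ?thesis
    by (simp add: beam_def flip: of_real_mult of_real_exp)
qed

section \<open>Unique determination\<close>

text \<open>The difference \<open>p ln (a + t) - q ln (b + t)\<close> takes the same value at three points, so by Rolle
  its derivative vanishes twice; but the derivative vanishes where the affine functions
  \<open>p (b + t)\<close> and \<open>q (a + t)\<close> agree, and two affine functions agreeing twice are equal.\<close>

lemma ln_profile_three_points:
  fixes p q k :: real
  assumes "0 < a" "0 < b" "0 < p" "0 < q" and t: "0 \<le> t0" "t0 < t1" "t1 < t2"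
    and eq: "\<And>t. t \<in> {t0, t1, t2} \<Longrightarrow> p * ln (a + t) = q * ln (b + t) + k"
  shows "p = q \<and> a = b"
proof -
  define h where "h t = p * ln (a + t) - q * ln (b + t)" for t
  define h' where "h' t = p / (a + t) - q / (b + t)" for t
  have deriv: "(h has_real_derivative h' t) (at t)" if "0 \<le> t" for t
    unfolding h_def h'_def using that assms(1,2)
    by (auto intro!: derivative_eq_intros simp: field_simps)
  have zero: "\<exists>c. u < c \<and> c < v \<and> h' c = 0" if uv: "0 \<le> u" "u < v" "h u = h v" for u v
  proof -
    obtain c where "c > u" "c < v" "h v - h u = (v - u) * h' c"
      using MVT2[OF uv(2), of h h'] deriv uv(1) by auto
    then show ?thesis using uv by auto
  qed
  have h: "h t = k" if "t \<in> {t0, t1, t2}" for t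
    using eq[OF that] by (simp add: h_def)
  obtain u where u: "t0 < u" "u < t1" "h' u = 0"
    using zero[of t0 t1] t h by auto
  obtain v where v: "t1 < v" "v < t2" "h' v = 0"
    using zero[of t1 t2] t h by auto
  have root: "p * (b + w) = q * (a + w)" if "0 \<le> w" "h' w = 0" for w
    using that assms(1,2) by (simp add: h'_def frac_eq_eq)
  have "p * (b + u) = q * (a + u)" "p * (b + v) = q * (a + v)"
    using u v t root by auto
  then have "(p - q) * (v - u) = 0" "p * b - q * a = (q - p) * u"
    by (simp_all add: algebra_simps)
  then show ?thesis
    using u v assms by auto
qed

theorem mainTheorem1:
  fixes J :: nat and t :: "nat \<Rightarrow> real"
  assumes "2 \<le> J"
    and "t 0 = 0"
    and "\<forall>j<J. t j < t (Suc j)"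
  shows
    "(\<forall>d>0. \<forall>s\<in>{0<..1}. \<forall>z>0. spread d s z = d / (2 * s + 1) * z powr (2 * s + 1)) \<and>
     (\<forall>C\<^sub>0 d lam s z\<^sub>0. (C\<^sub>0, d, lam, s, z\<^sub>0) \<in> beam_params \<longrightarrow>
        (\<forall>j\<le>J. has_bochner_integral lborel (\<lambda>x. beam C\<^sub>0 d lam s x (z\<^sub>0 + t j))
                 (complex_of_real (C\<^sub>0 * exp (- lam * (z\<^sub>0 + t j)))))) \<and>
     (\<forall>C\<^sub>0 d lam s z\<^sub>0 C\<^sub>0' d' lam' s' z\<^sub>0'.
        (C\<^sub>0, d, lam, s, z\<^sub>0) \<in> beam_params \<longrightarrow>
        (C\<^sub>0', d', lam', s', z\<^sub>0') \<in> beam_params \<longrightarrow>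
        (\<forall>j\<le>J. beam C\<^sub>0 d lam s 0 (z\<^sub>0 + t j) = beam C\<^sub>0' d' lam' s' 0 (z\<^sub>0' + t j)) \<longrightarrow>
        (\<forall>j\<le>J. (LINT x|lborel. beam C\<^sub>0 d lam s x (z\<^sub>0 + t j)) =
                 (LINT x|lborel. beam C\<^sub>0' d' lam' s' x (z\<^sub>0' + t j))) \<longrightarrow>
        (C\<^sub>0, d, lam, s, z\<^sub>0) = (C\<^sub>0', d', lam', s', z\<^sub>0'))"
proof -
  have t_nonneg: "0 \<le> t j" if "j \<le> J" for j
    using that
  proof (induction j)
    case (Suc j)
    then show ?case using assms(3) by (force dest: spec[of _ j])
  qed (use assms(2) in simp)
  have t: "t 0 = 0" "t 0 < t 1" "t 1 < t 2"
    using assms by (auto simp: numeral_2_eq_2)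
  have small: "j \<le> J" if "j \<in> {0, 1, 2}" for j
    using that assms(1) by auto
  have unique: "(C, d, lam, s, z) = (C', d', lam', s', z')"
    if par: "(C, d, lam, s, z) \<in> beam_params" "(C', d', lam', s', z') \<in> beam_params"
      and axis: "\<And>j. j \<le> J \<Longrightarrow> beam C d lam s 0 (z + t j) = beam C' d' lam' s' 0 (z' + t j)"
      and mass: "\<And>j. j \<le> J \<Longrightarrow>
        (LINT x|lborel. beam C d lam s x (z + t j)) = (LINT x|lborel. beam C' d' lam' s' x (z' + t j))"
    for C d lam s z C' d' lam' s' z'
  proof -
    have pos: "0 < C" "0 < d" "0 < s" "s \<le> 1" "0 < z" "0 < C'" "0 < d'" "0 < s'" "s' \<le> 1" "0 < z'"
      using par by (auto simp: beam_params_def)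
    have mass': "C * exp (- lam * (z + t j)) = C' * exp (- lam' * (z' + t j))" if j: "j \<le> J" for j
    proof -
      have "0 < z + t j" "0 < z' + t j" using pos t_nonneg[OF j] by auto
      then have "complex_of_real (C * exp (- lam * (z + t j))) = complex_of_real (C' * exp (- lam' * (z' + t j)))"
        using mass[OF j] has_bochner_integral_integral_eq[OF beam_mass[of d s "z + t j" C lam]]
          has_bochner_integral_integral_eq[OF beam_mass[of d' s' "z' + t j" C' lam']] pos
        by metis
      then show ?thesis by (simp only: of_real_eq_iff)
    qed
    have log_mass: "ln C - lam * (z + t j) = ln C' - lam' * (z' + t j)" if j: "j \<le> J" for j
      using arg_cong[OF mass'[OF j], of ln] pos by (simp add: ln_mult)
    have "(lam - lam') * (t 1 - t 0) = 0"
      using log_mass[OF small[of 0]] log_mass[OF small[of 1]] by (simp add: algebra_simps)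
    with t have lam: "lam = lam'" by simp
    \<comment> \<open>Dividing the axis data by the mass data leaves \<open>K (z + t) powr (- (2 + 1/s))\<close>, up to the factor
      \<open>1 / (4\<pi>\<^sup>2)\<close>.\<close>
    define K where "K = stretched_exp_mass s * (d / (2 * s + 1)) powr (- (1 / s))"
    define K' where "K' = stretched_exp_mass s' * (d' / (2 * s' + 1)) powr (- (1 / s'))"
    have K: "0 < K" "0 < K'"
      using pos by (auto simp: K_def K'_def stretched_exp_mass_pos)
    have profile: "K * (z + t j) powr (- (2 + 1 / s)) = K' * (z' + t j) powr (- (2 + 1 / s'))"
      if j: "j \<le> J" for j
    proof -
      have z: "0 < z + t j" "0 < z' + t j" using pos t_nonneg[OF j] by auto
      have "C * exp (- lam * (z + t j)) * (K * (z + t j) powr (- (2 + 1 / s)) / (4 * pi\<^sup>2)) =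
          C' * exp (- lam' * (z' + t j)) * (K' * (z' + t j) powr (- (2 + 1 / s')) / (4 * pi\<^sup>2))"
        using axis[OF j] unfolding beam_axis[OF pos(2,3) z(1)] beam_axis[OF pos(7,8) z(2)]
        unfolding K_def[symmetric] K'_def[symmetric] of_real_eq_iff .
      moreover have "C' * exp (- lam' * (z' + t j)) \<noteq> 0" using pos by simp
      ultimately show ?thesis
        unfolding mass'[OF j] by simp
    qed
    have log_profile: "(2 + 1 / s) * ln (z + t j) = (2 + 1 / s') * ln (z' + t j) + (ln K - ln K')"
      if j: "j \<le> J" for j
    proof -
      have "0 < z + t j" "0 < z' + t j" using pos t_nonneg[OF j] by auto
      then have "ln K - (2 + 1 / s) * ln (z + t j) = ln K' - (2 + 1 / s') * ln (z' + t j)"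
        using arg_cong[OF profile[OF j], of ln] K by (simp add: ln_mult ln_powr algebra_simps)
      then show ?thesis by linarith
    qed
    have "2 + 1 / s = 2 + 1 / s' \<and> z = z'"
    proof (rule ln_profile_three_points[of z z' "2 + 1 / s" "2 + 1 / s'" "t 0" "t 1" "t 2" "ln K - ln K'"])
      show "(2 + 1 / s) * ln (z + u) = (2 + 1 / s') * ln (z' + u) + (ln K - ln K')"
        if "u \<in> {t 0, t 1, t 2}" for u
        using that log_profile small by auto
    qed (use pos t in \<open>auto intro!: add_pos_pos\<close>)
    then have s: "s = s'" and z: "z = z'" using pos by auto
    have "C = C'" using mass'[of 0] by (simp add: lam z)
    moreover have "d = d'"
    proof -
      have "K = K'" using profile[of 0] pos t by (simp add: s z)
      then have "(d / (2 * s' + 1)) powr (- (1 / s')) = (d' / (2 * s' + 1)) powr (- (1 / s'))"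
        using stretched_exp_mass_pos[OF \<open>0 < s'\<close>] by (simp add: K_def K'_def s)
      from arg_cong[OF this, of "\<lambda>x. x powr (- s')"] show ?thesis
        using pos by (simp add: powr_powr)
    qed
    ultimately show ?thesis using lam s z by simp
  qed
  have "has_bochner_integral lborel (\<lambda>x. beam C d lam s x (z + t j))
      (complex_of_real (C * exp (- lam * (z + t j))))"
    if "(C, d, lam, s, z) \<in> beam_params" "j \<le> J" for C d lam s z j
    using that t_nonneg[OF that(2)] by (intro beam_mass) (auto simp: beam_params_def)
  then show ?thesis
    using unique spread_eq by (intro conjI allI impI ballI) auto
qed

end
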